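(* Let $s$ and $n$ be integers with $0 < s < n < \omega$, and let $\beta$ be an ordinal with $$\beta > (n-1)(2s+3) + (2s+1)(2s+2).$$ Then the graph $G(\beta, t^n_s)$ has a cycle of length $2s+3$.
   Context: Natural numbers are identified with the set of their predecessors, $k = \{0, \ldots, k-1\}$. All graphs are simple and undirected. For an ordinal $\beta$ and a positive integer $n$, $[\beta]^n$ is the set of $n$-element subsets of $\beta$, and $[\mathrm{Ord}]^n$ is the class of $n$-element sets of ordinals. A disjoint type of width $n$ is a function $t : 2n \to 2$ with $|t^{-1}(0)| = |t^{-1}(1)| = n$. If $a, b \in [\mathrm{Ord}]^n$ are disjoint and $a \cup b$ is enumerated in increasing order as $\{\alpha_i \mid i < 2n\}$, then the type of $a$ and $b$ is $t$, written $\mathrm{tp}(a,b) = t$, if $a = \{\alpha_i \mid i \in t^{-1}(0)\}$ and $b = \{\alpha_i \mid i \in t^{-1}(1)\}$. The type $\hat{t}$ is defined by $\hat{t}(i) = 1 - t(i)$ for all $i < 2n$. For $1 \leq s < n < \omega$, $t^n_s$ is the disjoint type of width $n$ whose binary string representation consists of $s$ copies of '0', followed by $n-s$ copies of '01', followed by $s$ copies of '1'. That is, for $i < 2n$: $t^n_s(i) = 0$ if $i < s$; $t^n_s(i) = 0$ if $s \leq i < 2n - s$ and $i - s$ is even; $t^n_s(i) = 1$ if $s \leq i < 2n - s$ and $i - s$ is odd; $t^n_s(i) = 1$ if $i \geq 2n - s$. For example, $t^5_2 = 0001010111$. For an ordinal $\beta$ and a disjoint type $t$ of width $n$, the graph $G(\beta,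 t)$ has vertex set $[\beta]^n$, and for $a, b \in [\beta]^n$, $\{a,b\}$ is an edge if and only if $a$ and $b$ are disjoint and $\mathrm{tp}(a,b) \in \{t, \hat{t}\}$. *)

theory Defs
  imports Main "HOL-Library.FuncSet" "HOL-Library.Ramsey"
begin

unbundle cardinal_syntax

text \<open>
  An ordinal is represented by an arbitrary well-order \<open>\<beta>\<close> (in the sense of \<^const>\<open>Well_order\<close>, a
  reflexive relation on its field) of that order type. Ordinals are compared by \<^const>\<open>ordLess\<close>
  (written \<open><o\<close>), and the finite ordinal \<open>k = {0, ..., k - 1}\<close> is \<^term>\<open>natLeq_on k\<close>. The set
  \<open>[\<beta>]\<^sup>n\<close> is the library's \<^term>\<open>nsets (Field \<beta>) n\<close>.
\<close>

section \<open>Disjoint types\<close>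

text \<open>Functions \<open>2n \<rightarrow> 2\<close> are extensional functions on \<open>{..<2 * n}\<close>.\<close>

definition disjoint_type :: "nat \<Rightarrow> (nat \<Rightarrow> nat) \<Rightarrow> bool" where
  "disjoint_type n t \<longleftrightarrow>
     t \<in> {..<2 * n} \<rightarrow>\<^sub>E {..<2} \<and>
     card {i \<in> {..<2 * n}. t i = 0} = n \<and> card {i \<in> {..<2 * n}. t i = 1} = n"

definition hat :: "nat \<Rightarrow> (nat \<Rightarrow> nat) \<Rightarrow> (nat \<Rightarrow> nat)" where
  "hat n t = (\<lambda>i\<in>{..<2 * n}. 1 - t i)"

definition std_type :: "nat \<Rightarrow> nat \<Rightarrow> (nat \<Rightarrow> nat)" where
  "std_type n s = (\<lambda>i\<in>{..<2 * n}.
     if i < s then 0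
     else if i < 2 * n - s then (if even (i - s) then 0 else 1)
     else 1)"

text \<open>\<open>has_tp \<beta> n a b t\<close> means \<open>tp(a, b) = t\<close>, where \<open>\<alpha>\<close> is the increasing enumeration of
  \<open>a \<union> b\<close> with respect to \<open>\<beta>\<close>.\<close>

definition has_tp :: "'a rel \<Rightarrow> nat \<Rightarrow> 'a set \<Rightarrow> 'a set \<Rightarrow> (nat \<Rightarrow> nat) \<Rightarrow> bool" where
  "has_tp \<beta> n a b t \<longleftrightarrow>
     a \<inter> b = {} \<and>
     (\<exists>\<alpha> :: nat \<Rightarrow> 'a.
        (\<forall>i j. i < j \<and> j < 2 * n \<longrightarrow> (\<alpha> i, \<alpha> j) \<in> \<beta> \<and> \<alpha> i \<noteq> \<alpha> j) \<and>
        a \<union> b = \<alpha> ` {..<2 * n} \<and>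
        a = \<alpha> ` {i \<in> {..<2 * n}. t i = 0} \<and>
        b = \<alpha> ` {i \<in> {..<2 * n}. t i = 1})"

section \<open>Graphs and cycles\<close>

text \<open>A simple undirected graph is a pair \<open>(V, E)\<close> with \<open>E \<subseteq> [V]\<^sup>2\<close>; vertex sets may be infinite.\<close>

type_synonym 'v sgraph = "'v set \<times> 'v set set"

definition simple_graph :: "'v sgraph \<Rightarrow> bool" where
  "simple_graph G \<longleftrightarrow> snd G \<subseteq> nsets (fst G) 2"

definition has_cycle_of_length :: "'v sgraph \<Rightarrow> nat \<Rightarrow> bool" where
  "has_cycle_of_length G k \<longleftrightarrow>
     k \<ge> 3 \<and>
     (\<exists>c :: nat \<Rightarrow> 'v.
        inj_on c {..<k} \<and> c ` {..<k} \<subseteq> fst G \<and>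
        (\<forall>i<k. {c i, c (Suc i mod k)} \<in> snd G))"

definition type_graph :: "'a rel \<Rightarrow> nat \<Rightarrow> (nat \<Rightarrow> nat) \<Rightarrow> 'a set sgraph" where
  "type_graph \<beta> n t =
     (nsets (Field \<beta>) n,
      {{a, b} | a b. a \<in> nsets (Field \<beta>) n \<and> b \<in> nsets (Field \<beta>) n \<and> a \<inter> b = {} \<and>
                     (\<exists>u \<in> {t, hat n t}. has_tp \<beta> n a b u)})"

section \<open>Consistency of the definitions\<close>

lemma std_type_5_2: "map (std_type 5 2) [0..<10] = [0,0,0,1,0,1,0,1,1,1]"
  by (simp add: std_type_def upt_rec)

lemma disjoint_type_std_type:
  assumes "0 < s" "s < n"
  shows "disjoint_type n (std_type n s)"
proof -
  let ?t = "std_type n s"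
  let ?Z = "{i \<in> {..<2 * n}. ?t i = 0}" and ?O = "{i \<in> {..<2 * n}. ?t i = 1}"
  have bij: "bij_betw (\<lambda>i. 2 * n - 1 - i) ?Z ?O"
  proof (rule bij_betw_byWitness[where f' = "\<lambda>i. 2 * n - 1 - i"])
    show "(\<lambda>i. 2 * n - 1 - i) ` ?Z \<subseteq> ?O"
      using assms by (auto simp: std_type_def split: if_splits; presburger)
    show "(\<lambda>i. 2 * n - 1 - i) ` ?O \<subseteq> ?Z"
      using assms by (auto simp: std_type_def split: if_splits; presburger)
  qed auto
  have val: "?t i = 0 \<or> ?t i = 1" if "i < 2 * n" for i
    using that by (auto simp: std_type_def)
  have "?Z \<union> ?O = {..<2 * n}" "?Z \<inter> ?O = {}"
    using val by auto
  then have "card ?Z + card ?O = 2 * n"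
    using card_Un_disjoint[of ?Z ?O] by simp
  moreover have "card ?Z = card ?O"
    using bij by (rule bij_betw_same_card)
  moreover have "?t \<in> {..<2 * n} \<rightarrow>\<^sub>E {..<2}"
    by (auto simp: std_type_def)
  ultimately show ?thesis
    by (simp add: disjoint_type_def)
qed

lemma disjoint_type_cases:
  assumes "disjoint_type n t" "i < 2 * n"
  shows "t i = 0 \<or> t i = 1"
proof -
  have "t i < 2" using assms by (auto simp: disjoint_type_def PiE_iff)
  then show ?thesis by auto
qed

lemma hat_hat:
  assumes "disjoint_type n t"
  shows "hat n (hat n t) = t"
proof
  fix i
  show "hat n (hat n t) i = t i"
  proof (cases "i < 2 * n")
    case True
    then show ?thesis
      using disjoint_type_cases[OF assms True] by (auto simp: hat_def)
  next
    case False
    then have "t i = undefined"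
      using assms by (simp add: disjoint_type_def PiE_iff extensional_def)
    with False show ?thesis by (simp add: hat_def)
  qed
qed

lemma hat_fibres:
  assumes "disjoint_type n t"
  shows "{i \<in> {..<2 * n}. hat n t i = 0} = {i \<in> {..<2 * n}. t i = 1}"
    and "{i \<in> {..<2 * n}. hat n t i = 1} = {i \<in> {..<2 * n}. t i = 0}"
proof -
  have "(hat n t i = 0 \<longleftrightarrow> t i = 1) \<and> (hat n t i = 1 \<longleftrightarrow> t i = 0)" if "i < 2 * n" for i
    using disjoint_type_cases[OF assms that] that by (auto simp: hat_def)
  then show "{i \<in> {..<2 * n}. hat n t i = 0} = {i \<in> {..<2 * n}. t i = 1}"
    and "{i \<in> {..<2 * n}. hat n t i = 1} = {i \<in> {..<2 * n}. t i = 0}"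
    by blast+
qed

lemma has_tp_swap:
  assumes "disjoint_type n t" "has_tp \<beta> n a b t"
  shows "has_tp \<beta> n b a (hat n t)"
proof -
  note * = hat_fibres[OF assms(1)]
  show ?thesis
    using assms(2) unfolding has_tp_def * Un_commute[of b a] Int_commute[of b a]
    by (elim conjE exE, intro conjI exI)
qed

lemma disjoint_type_hat:
  assumes "disjoint_type n t"
  shows "disjoint_type n (hat n t)"
proof -
  have "hat n t \<in> {..<2 * n} \<rightarrow>\<^sub>E {..<2}"
    unfolding hat_def by (rule restrict_PiE_iff[THEN iffD2]) (auto simp: less_2_cases_iff)
  then show ?thesis
    using assms unfolding disjoint_type_def hat_fibres[OF assms] by blast
qed

lemma simple_graph_type_graph:
  assumes "0 < n"
  shows "simple_graph (type_graph \<beta> n t)"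
proof -
  have "{a, b} \<in> nsets (nsets (Field \<beta>) n) 2"
    if "a \<in> nsets (Field \<beta>) n" "b \<in> nsets (Field \<beta>) n" "a \<inter> b = {}" for a b :: "'a set"
  proof -
    have "a \<noteq> b" using that assms by (auto simp: nsets_def)
    then show ?thesis using that(1,2) by (auto simp: nsets_def)
  qed
  then show ?thesis
    unfolding simple_graph_def type_graph_def fst_conv snd_conv by (intro subsetI) blast
qed

lemma type_graph_edge_iff:
  assumes "disjoint_type n t"
  shows "{a, b} \<in> snd (type_graph \<beta> n t) \<longleftrightarrow>
    a \<in> nsets (Field \<beta>) n \<and> b \<in> nsets (Field \<beta>) n \<and> a \<inter> b = {} \<and>
    (has_tp \<beta> n a b t \<or> has_tp \<beta> n a b (hat n t))"
proof -
  have "has_tp \<beta> n b a t \<or> has_tp \<beta> n b a (hat n t) \<longleftrightarrow>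
      has_tp \<beta> n a b t \<or> has_tp \<beta> n a b (hat n t)" for a b
    using has_tp_swap[OF assms] has_tp_swap[OF disjoint_type_hat[OF assms]] hat_hat[OF assms]
    by metis
  then show ?thesis
    by (auto simp: type_graph_def doubleton_eq_iff)
qed

end

theory Submission
  imports Defs "HOL-Number_Theory.Cong"
begin

text \<open>
  If \<open>a\<close> and \<open>b\<close> are increasing \<open>n\<close>-sequences, then \<open>a\<close> and \<open>b\<close> have type \<open>t\<^sup>n\<^sub>s\<close> precisely when
  \<open>b\<^sub>j\<close> lies strictly between \<open>a\<^bsub>j+s\<^esub>\<close> and \<open>a\<^bsub>j+s+1\<^esub>\<close> whenever these exist. For two arithmetic
  progressions with the same difference \<open>M\<close>, this holds as soon as the second starts more than
  \<open>s M\<close> and less than \<open>(s + 1) M\<close> after the first; a step along an edge therefore moves the starting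
  point by such a distance, forwards or backwards.

  An odd cycle has to balance forward steps against a different number of backward steps. With
  \<open>s + 2\<close> forward steps that are as short as possible, \<open>s M + 1\<close>, and \<open>s + 1\<close> backward steps that
  are as long as possible, \<open>(s + 1) M - 1\<close>, the total displacement is \<open>(2 s + 3) - M\<close>. So \<open>M = 2 s + 3\<close>
  closes the cycle, and for this \<open>M\<close> the two step lengths factor as \<open>(s + 1) (2 s + 1)\<close> and
  \<open>(s + 2) (2 s + 1)\<close>. In units of \<open>2 s + 1\<close> the steps are \<open>+ (s + 1)\<close> and \<open>- (s + 2)\<close>, which agree
  modulo \<open>2 s + 3\<close>. Hence the walk can be kept within the starting points \<open>p (2 s + 1)\<close> with
  \<open>p < 2 s + 3\<close> by repeatedly adding \<open>s + 1\<close> to \<open>p\<close> modulo \<open>2 s + 3\<close>, and it visits each of them exactly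
  once because \<open>s + 1\<close> and \<open>2 s + 3\<close> are coprime.

  The largest ordinal used is the last term \<open>(2 s + 2) (2 s + 1) + (2 s + 3) (n - 1)\<close> of the
  progression with \<open>p = 2 s + 2\<close>, which is the bound in the theorem. The cycle is carried over to a
  well-order that is longer than this number by an increasing map (\<open>increasing_map_into_longer\<close>).
\<close>

text \<open>The map extends the isomorphism of \<open>K\<close> with a proper initial segment by one more value, the
  least element beyond the segment; this is why \<open>K\<close> itself is in the domain.\<close>

lemma increasing_map_into_longer:
  fixes \<beta> :: "'a rel"
  assumes "Well_order \<beta>" "natLeq_on K <o \<beta>"
  obtains f :: "nat \<Rightarrow> 'a" where "\<And>i. i \<le> K \<Longrightarrow> f i \<in> Field \<beta>"
    and "\<And>i j. i < j \<Longrightarrow> j \<le> K \<Longrightarrow> (f i, f j) \<in> \<beta> \<and> f i \<noteq> f j"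
proof -
  obtain m where m: "m \<in> Field \<beta>" "natLeq_on K =o Restr \<beta> (underS \<beta> m)"
    using assms ordLess_iff_ordIso_Restr[OF assms(1) natLeq_on_Well_order] by blast
  then obtain g where g: "iso (natLeq_on K) (Restr \<beta> (underS \<beta> m)) g"
    by (auto simp: ordIso_def)
  have fieldR: "Field (Restr \<beta> (underS \<beta> m)) = underS \<beta> m"
    by (simp add: Field_Restr_ofilter assms(1) wo_rel.intro wo_rel.underS_ofilter)
  have bij: "bij_betw g {..<K} (underS \<beta> m)"
    using g unfolding iso_def fieldR by (simp add: Field_natLeq_on lessThan_def)
  have below: "g i \<in> underS \<beta> m" if "i < K" for i
    using bij that by (auto simp: bij_betw_def)
  have le: "(g i, g j) \<in> \<beta> \<and> g i \<noteq> g j" if "i < j" "j < K" for i j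
    using iso_forward[OF _ g, of i j] bij_betw_imp_inj_on[OF bij, THEN inj_onD, of i j] that
    by auto
  show ?thesis
  proof (rule that[of "\<lambda>i. if i < K then g i else m"])
    show "(if i < K then g i else m) \<in> Field \<beta>" for i
      using below[of i] m(1) by (auto simp: underS_def Field_def)
    show "((if i < K then g i else m), (if j < K then g j else m)) \<in> \<beta> \<and>
        (if i < K then g i else m) \<noteq> (if j < K then g j else m)" if "i < j" "j \<le> K" for i j
      using that le[of i j] below[of i] by (auto simp: underS_def)
  qed
qed

text \<open>The enumeration is read off the string \<open>0\<^sup>s (01)\<^bsup>n-s\<^esup> 1\<^sup>s\<close>: the \<open>j\<close>-th zero is at position \<open>j\<close> if
  \<open>j < s\<close> and at \<open>2 j - s\<close> otherwise; the \<open>j\<close>-th one is at \<open>s + 2 j + 1\<close> if \<open>j < n - s\<close> and at \<open>n + j\<close>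
  otherwise.\<close>

lemma has_tp_std_typeI:
  fixes f :: "nat \<Rightarrow> 'a" and a b :: "nat \<Rightarrow> nat"
  assumes "s < n"
    and f: "\<And>i j. i < j \<Longrightarrow> j \<le> K \<Longrightarrow> (f i, f j) \<in> \<beta> \<and> f i \<noteq> f j"
    and a: "\<And>j. Suc j < n \<Longrightarrow> a j < a (Suc j)"
    and b: "\<And>j. Suc j < n \<Longrightarrow> b j < b (Suc j)" "\<And>j. j < n \<Longrightarrow> b j \<le> K"
    and ab: "\<And>j. j + s < n \<Longrightarrow> a (j + s) < b j"
    and ba: "\<And>j. Suc (j + s) < n \<Longrightarrow> b j < a (Suc (j + s))"
  shows "has_tp \<beta> n (f ` a ` {..<n}) (f ` b ` {..<n}) (std_type n s)"
proof -
  define \<alpha> where "\<alpha> i = (if i < s then a i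
    else if i < 2 * n - s then
      (if even (i - s) then a ((i - s) div 2 + s) else b ((i - s) div 2))
    else b (i - n))" for i
  let ?Z = "{i \<in> {..<2 * n}. std_type n s i = 0}" and ?O = "{i \<in> {..<2 * n}. std_type n s i = 1}"
  have step: "\<alpha> i < \<alpha> (Suc i)" if i: "Suc i < 2 * n" for i
  proof -
    consider "Suc i \<le> s" | k where "i = s + 2 * k" "k + s < n"
      | k where "i = Suc (s + 2 * k)" "Suc (k + s) < n"
      | "Suc i = 2 * n - s" "s > 0" | "2 * n - s \<le> i"
    proof (cases "s \<le> i \<and> i < 2 * n - s")
      case True
      then show ?thesis
      proof (cases "even (i - s)")
        case True
        then obtain k where "i - s = 2 * k" by (elim evenE)
        with \<open>s \<le> i \<and> i < 2 * n - s\<close> show ?thesis by (intro that(2)[of k]) auto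
      next
        case False
        then obtain k where "i - s = 2 * k + 1" by (elim oddE)
        with \<open>s \<le> i \<and> i < 2 * n - s\<close> i that(3)[of k] that(4) show ?thesis
          by (cases "Suc (k + s) < n") auto
      qed
    qed (use that(1,5) in force)
    then show ?thesis
    proof cases
      case 1
      then show ?thesis using a[of i] assms(1) by (auto simp: \<alpha>_def)
    next
      case 2
      then show ?thesis using ab[of k] by (auto simp: \<alpha>_def)
    next
      case 3
      then show ?thesis using ba[of k] by (auto simp: \<alpha>_def)
    next
      case 4
      then have "i = s + 2 * (n - s - 1) + 1" "Suc i - n = Suc (n - s - 1)"
        using assms(1) by auto
      then show ?thesis using 4 assms(1) b(1)[of "n - s - 1"] by (auto simp: \<alpha>_def)
    next
      case 5
      then have "Suc i - n = Suc (i - n)" using assms(1) by auto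
      then show ?thesis using 5 assms(1) i b(1)[of "i - n"] by (auto simp: \<alpha>_def)
    qed
  qed
  have mono: "\<alpha> i < \<alpha> j" if "i < j" "j < 2 * n" for i j
    using that
  proof (induction j)
    case (Suc j)
    then show ?case using step[of j] by (cases "i = j") auto
  qed simp
  have mono_le: "\<alpha> i \<le> \<alpha> j" if "i \<le> j" "j < 2 * n" for i j
    using mono[of i j] that by (cases "i = j") auto
  have "\<alpha> i \<le> K" if "i < 2 * n" for i
  proof -
    have "\<alpha> i \<le> \<alpha> (2 * n - 1)"
      using mono_le[of i "2 * n - 1"] that by simp
    also have "\<alpha> (2 * n - 1) = b (n - 1)"
      using assms(1) by (cases n; cases "s = 0") (auto simp: \<alpha>_def)
    also have "\<dots> \<le> K" using b(2) assms(1) by simp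
    finally show ?thesis .
  qed
  then have incr: "(f (\<alpha> i), f (\<alpha> j)) \<in> \<beta> \<and> f (\<alpha> i) \<noteq> f (\<alpha> j)" if "i < j" "j < 2 * n" for i j
    using f mono that by blast
  have Z: "\<alpha> ` ?Z = a ` {..<n}"
  proof
    show "\<alpha> ` ?Z \<subseteq> a ` {..<n}"
      using assms(1) by (auto simp: \<alpha>_def std_type_def split: if_splits)
    show "a ` {..<n} \<subseteq> \<alpha> ` ?Z"
    proof
      fix x assume "x \<in> a ` {..<n}"
      then obtain j where j: "x = a j" "j < n" by blast
      show "x \<in> \<alpha> ` ?Z"
      proof (cases "j < s")
        case True
        then show ?thesis
          using j assms(1) by (intro image_eqI[of _ _ j]) (auto simp: \<alpha>_def std_type_def)
      next
        case False
        define k where "k = j - s"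
        then have k: "j = k + s" using False by simp
        have "x = \<alpha> (s + 2 * k)" "s + 2 * k \<in> ?Z"
          using j(2) by (auto simp: j(1) k \<alpha>_def std_type_def)
        then show ?thesis by (rule image_eqI)
      qed
    qed
  qed
  have O: "\<alpha> ` ?O = b ` {..<n}"
  proof
    show "\<alpha> ` ?O \<subseteq> b ` {..<n}"
      using assms(1) by (auto simp: \<alpha>_def std_type_def split: if_splits)
    show "b ` {..<n} \<subseteq> \<alpha> ` ?O"
    proof
      fix x assume "x \<in> b ` {..<n}"
      then obtain j where j: "x = b j" "j < n" by blast
      show "x \<in> \<alpha> ` ?O"
      proof (cases "j + s < n")
        case True
        then show ?thesis
          using j by (intro image_eqI[of _ _ "Suc (s + 2 * j)"]) (auto simp: \<alpha>_def std_type_def)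
      next
        case False
        then show ?thesis
          using j assms(1) by (intro image_eqI[of _ _ "n + j"]) (auto simp: \<alpha>_def std_type_def)
      qed
    qed
  qed
  have union: "{..<2 * n} = ?Z \<union> ?O"
    by (auto simp: std_type_def)
  have inj: "inj_on (f \<circ> \<alpha>) {..<2 * n}"
    using incr by (intro linorder_inj_onI') auto
  have "(f \<circ> \<alpha>) ` ?Z \<inter> (f \<circ> \<alpha>) ` ?O = (f \<circ> \<alpha>) ` (?Z \<inter> ?O)"
    by (rule inj_on_image_Int[OF inj, symmetric]) auto
  also have "\<dots> = {}" by auto
  finally have disj: "(f \<circ> \<alpha>) ` ?Z \<inter> (f \<circ> \<alpha>) ` ?O = {}" .
  have Z': "f ` a ` {..<n} = (f \<circ> \<alpha>) ` ?Z" and O': "f ` b ` {..<n} = (f \<circ> \<alpha>) ` ?O"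
    by (simp_all only: Z[symmetric] O[symmetric] image_comp)
  have "(f \<circ> \<alpha>) ` ?Z \<union> (f \<circ> \<alpha>) ` ?O = (f \<circ> \<alpha>) ` {..<2 * n}"
    by (subst union) (rule image_Un[symmetric])
  then show ?thesis
    unfolding has_tp_def Z' O' using disj incr by (intro conjI exI[of _ "f \<circ> \<alpha>"]) auto
qed

theorem proposition10:
  fixes s n :: nat and \<beta> :: "'a rel"
  assumes "0 < s" and "s < n"
    and "Well_order \<beta>"
    and "natLeq_on ((n - 1) * (2 * s + 3) + (2 * s + 1) * (2 * s + 2)) <o \<beta>"
  shows "has_cycle_of_length (type_graph \<beta> n (std_type n s)) (2 * s + 3)"
proof -
  define M where "M = 2 * s + 3"
  define K where "K = (n - 1) * M + (2 * s + 1) * (2 * s + 2)"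
  define A where "A p j = p * (2 * s + 1) + M * j" for p j
  obtain f :: "nat \<Rightarrow> 'a" where field: "\<And>i. i \<le> K \<Longrightarrow> f i \<in> Field \<beta>"
    and incr: "\<And>i j. i < j \<Longrightarrow> j \<le> K \<Longrightarrow> (f i, f j) \<in> \<beta> \<and> f i \<noteq> f j"
    using increasing_map_into_longer[OF assms(3) assms(4)[folded M_def, folded K_def]] by blast
  have inj: "inj_on f {..K}"
    using incr by (intro linorder_inj_onI') auto
  define V where "V p = f ` A p ` {..<n}" for p
  have bound: "A p j \<le> K" if "p < M" "j < n" for p j
  proof -
    have "p * (2 * s + 1) \<le> (2 * s + 2) * (2 * s + 1)" "M * j \<le> M * (n - 1)"
      using that by (intro mult_le_mono; simp add: M_def)+
    then have "A p j \<le> (2 * s + 2) * (2 * s + 1) + M * (n - 1)"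
      unfolding A_def by (rule add_mono)
    then show ?thesis by (simp only: K_def ac_simps)
  qed
  have vertex: "V p \<in> nsets (Field \<beta>) n" if "p < M" for p
  proof -
    have sub: "A p ` {..<n} \<subseteq> {..K}" using bound that by auto
    have "inj_on (A p) {..<n}" by (auto simp: inj_on_def A_def M_def)
    moreover have "inj_on f (A p ` {..<n})" using inj sub by (rule inj_on_subset)
    ultimately have "card (V p) = n" by (simp add: V_def card_image)
    then show ?thesis using sub field by (auto simp: nsets_def V_def)
  qed
  have edge: "{V p, V (p + e)} \<in> snd (type_graph \<beta> n (std_type n s))"
    if e: "e \<in> {s + 1, s + 2}" and p: "p + e < M" for p e
  proof -
    \<comment> \<open>For \<open>M = 2 s + 3\<close>, one has \<open>(s + 1) (2 s + 1) = s M + 1\<close> and \<open>(s + 2) (2 s + 1) = (s + 1) M - 1\<close>.\<close>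
    have d: "M * s < e * (2 * s + 1)" "e * (2 * s + 1) < M * s + M"
      using e by (auto simp: M_def algebra_simps)
    have "has_tp \<beta> n (V p) (V (p + e)) (std_type n s)"
      unfolding V_def
    proof (rule has_tp_std_typeI[where K = K])
      show "A (p + e) j \<le> K" if "j < n" for j
        using bound p that by blast
    qed (use assms(2) incr d in \<open>auto simp: A_def algebra_simps M_def\<close>)
    moreover from this have "V p \<inter> V (p + e) = {}" by (simp add: has_tp_def)
    ultimately show ?thesis
      unfolding type_graph_edge_iff[OF disjoint_type_std_type[OF assms(1,2)]]
      using vertex[of p] vertex[of "p + e"] p by simp
  qed
  \<comment> \<open>The starting point of a progression is the least element of its range.\<close>
  have inj_V: "p = q" if "V p = V q" "p < M" "q < M" for p q
  proof -
    have "A p ` {..<n} = A q ` {..<n}"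
      using inj_on_image_eq_iff[OF inj, of "A p ` {..<n}" "A q ` {..<n}"] that bound
      by (auto simp: V_def)
    moreover have "Min (A r ` {..<n}) = r * (2 * s + 1)" for r
    proof (rule Min_eqI)
      show "r * (2 * s + 1) \<in> A r ` {..<n}"
        using assms(2) by (intro image_eqI[of _ _ 0]) (auto simp: A_def)
    qed (auto simp: A_def)
    ultimately have "p * (2 * s + 1) = q * (2 * s + 1)" by metis
    then show ?thesis by (simp only: mult_cancel2) simp
  qed
  define c where "c i = V (i * (s + 1) mod M)" for i
  have "inj_on c {..<M}"
  proof (rule inj_onI)
    fix i j assume ij: "i \<in> {..<M}" "j \<in> {..<M}" "c i = c j"
    then have "[i * (s + 1) = j * (s + 1)] (mod M)"
      using inj_V[of "i * (s + 1) mod M" "j * (s + 1) mod M"]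
      by (simp add: c_def cong_def M_def)
    moreover have "coprime (s + 1) M"
    proof (rule coprimeI)
      fix d assume d: "d dvd s + 1" "d dvd M"
      have "M = 2 * (s + 1) + 1" by (simp add: M_def)
      with d show "is_unit d" using dvd_add_right_iff[OF dvd_mult[OF d(1)], of 2 1] by simp
    qed
    ultimately have "[i = j] (mod M)" using cong_mult_rcancel_nat by blast
    then show "i = j" using ij by (simp add: cong_less_modulus_unique_nat)
  qed
  moreover have "c ` {..<M} \<subseteq> fst (type_graph \<beta> n (std_type n s))"
    using vertex by (auto simp: c_def type_graph_def M_def)
  moreover have "{c i, c (Suc i mod M)} \<in> snd (type_graph \<beta> n (std_type n s))" for i
  proof -
    define p where "p = i * (s + 1) mod M"
    have p: "p < M" by (simp add: p_def M_def)
    have "(Suc i mod M) * (s + 1) mod M = (i * (s + 1) + (s + 1)) mod M"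
      by (simp only: mod_mult_left_eq mult_Suc add.commute)
    also have "\<dots> = (p + (s + 1)) mod M" by (simp only: p_def mod_add_left_eq)
    finally have c: "c i = V p" "c (Suc i mod M) = V ((p + (s + 1)) mod M)"
      by (simp_all add: c_def p_def)
    show ?thesis
    proof (cases "p + (s + 1) < M")
      case True
      then show ?thesis using edge[of "s + 1" p] by (simp add: c)
    next
      case False
      \<comment> \<open>Reducing modulo \<open>M\<close> turns the step into a backward step of \<open>M - (s + 1) = s + 2\<close>.\<close>
      define q where "q = p - (s + 2)"
      have q: "p = q + (s + 2)" "p + (s + 1) = q + M" "q < M"
        using False p by (auto simp: q_def M_def)
      then have "(p + (s + 1)) mod M = q" by (simp only: mod_add_self2 mod_less)
      then show ?thesis using edge[of "s + 2" q] p q(1) by (simp add: c insert_commute)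
    qed
  qed
  ultimately show ?thesis
    unfolding has_cycle_of_length_def M_def by (intro conjI exI[of _ c]) auto
qed

end
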